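(* Let $u = u_0 u_1 u_2 \ldots$ be an infinite non-ultimately periodic sequence on a finite alphabet. Then, for all $k \geq 1$, we have $$\mathrm{pal}_u(k) < \frac{16}{k}\, \mathrm{fac}_u\left(k + \left\lfloor \frac{k}{4} \right\rfloor\right).$$
   Context: A factor of $u$ is a finite word occurring in $u$ as a block of consecutive letters. $\mathrm{fac}_u(n)$ denotes the number of distinct words of length $n$ that are factors of $u$, and $\mathrm{pal}_u(n)$ the number of distinct palindromes (words equal to their reversal) of length $n$ that are factors of $u$. The sequence $u$ is ultimately periodic if there exist integers $\ell \geq 0$ and $T \geq 1$ such that $u_{n+T} = u_n$ for all $n \geq \ell$. *)

theory Defs
  imports Complex_Main "HOL-Library.Omega_Words_Fun"
begin

definition factors :: "'a word \<Rightarrow> 'a list set" where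
  "factors u = {w. \<exists>i j. i \<le> j \<and> w = u [i \<rightarrow> j]}"

definition palindrome :: "'a list \<Rightarrow> bool" where
  "palindrome w \<longleftrightarrow> rev w = w"

definition fac :: "'a word \<Rightarrow> nat \<Rightarrow> nat" where
  "fac u n = card {w \<in> factors u. length w = n}"

definition pal :: "'a word \<Rightarrow> nat \<Rightarrow> nat" where
  "pal u n = card {w \<in> factors u. length w = n \<and> palindrome w}"

definition ultimately_periodic :: "'a word \<Rightarrow> bool" where
  "ultimately_periodic u \<longleftrightarrow> (\<exists>l T. T \<ge> 1 \<and> (\<forall>n\<ge>l. u (n + T) = u n))"

end

theory Submission
  imports Defs
begin

text \<open>
  Put \<open>m = k div 4\<close> and \<open>n = k + m\<close>, and count pairs consisting of a palindrome of length
  \<open>k\<close> and a factor of length \<open>n\<close> that contains it.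

  A factor of length \<open>n\<close> contains at most two palindromes of length \<open>k\<close>
  (\<open>window_palindromes_le_2\<close>).  Indeed, composing the reflections about the centres of two
  palindromes at distance \<open>d\<close> is a translation by \<open>2 * d\<close>, so the block that they cover has
  period \<open>2 * d\<close>.  Three palindromes give two such periods, which by the Fine-Wilf argument
  combine into one period; modulo that period only two classes of positions remain.

  Conversely, a word of length \<open>k\<close> that occurs at some position \<open>s \<ge> m\<close> is contained in at least
  \<open>m + 1\<close> factors of length \<open>n\<close> (\<open>late_word_many_windows\<close>).  The candidates are the windows
  that start at \<open>s - m, \<dots>, s\<close>.  Two of them coincide only if the word has a small period
  \<open>q\<close>; since \<open>u\<close> is not ultimately periodic, the run of period \<open>q\<close> around the word stops
  somewhere, and for the last occurrence of the word in that run the place where the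
  period breaks tells the windows apart.

  Hence, if \<open>N\<close> palindromes occur at a position \<open>\<ge> m\<close>, then \<open>(m + 1) * N \<le> 2 * fac u n\<close>.  The
  remaining palindromes all lie in the prefix of length \<open>n\<close>, so there are at most two of
  them.  Since \<open>m + 1 > k / 4\<close>, the first bound gives \<open>N \<le> 8 / k * fac u n\<close>.  The two extra
  palindromes fit into a second summand \<open>8 / k * fac u n\<close>, which exceeds \<open>2\<close> because already
  the windows around a single word show that \<open>fac u n \<ge> m + 1 > k / 4\<close>.
\<close>

section \<open>Periods of blocks\<close>

definition has_period :: "'a word \<Rightarrow> nat \<Rightarrow> nat \<Rightarrow> nat \<Rightarrow> bool" where
  "has_period u q l h \<longleftrightarrow> (\<forall>i\<ge>l. i + q < h \<longrightarrow> u i = u (i + q))"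

lemma has_periodD: "has_period u q l h \<Longrightarrow> l \<le> i \<Longrightarrow> i + q < h \<Longrightarrow> u i = u (i + q)"
  by (simp add: has_period_def)

lemma has_period_subblock:
  "has_period u q l h \<Longrightarrow> l \<le> l' \<Longrightarrow> h' \<le> h \<Longrightarrow> has_period u q l' h'"
  by (auto simp: has_period_def)

lemma has_period_mult:
  assumes "has_period u q l h" "l \<le> i" "i + q * r < h"
  shows "u i = u (i + q * r)"
  using assms(3)
proof (induction r)
  case (Suc r)
  then show ?case
    using has_periodD[OF assms(1), of "i + q * r"] assms(2) by (simp add: algebra_simps)
qed simp

lemma has_period_dvd:
  assumes "has_period u q l h" "l \<le> i" "i + d < h" "q dvd d"
  shows "u i = u (i + d)"
  using assms(4) has_period_mult[OF assms(1,2)] assms(3) by (auto elim!: dvdE)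

lemma has_period_union:
  assumes "has_period u q l h" "has_period u q l' h'" "l' + q \<le> h"
  shows "has_period u q l h'"
  unfolding has_period_def
proof (intro allI impI)
  fix i assume "l \<le> i" "i + q < h'"
  then show "u i = u (i + q)"
    using assms by (cases "i + q < h") (auto simp: has_period_def)
qed

text \<open>
  The two periods are treated as in Euclid's algorithm: a step of length \<open>q - p\<close> is a step
  \<open>q\<close> forward and \<open>p\<close> back, in whichever order stays inside the block; a block of length
  \<open>p + q\<close> always leaves room for one of the two orders.
\<close>

lemma has_period_gcd:
  assumes "has_period u p l h" "has_period u q l h" "l + p + q \<le> h"
  shows "has_period u (gcd p q) l h"
  using assms
proof (induction "p + q" arbitrary: p q rule: less_induct)
  case less
  have diff: "has_period u (q - p) l h"
    if "has_period u p l h" "has_period u q l h" "l + p + q \<le> h" "p \<le> q" for p q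
    unfolding has_period_def
  proof (intro allI impI)
    fix i assume i: "l \<le> i" "i + (q - p) < h"
    show "u i = u (i + (q - p))"
    proof (cases "i + q < h")
      case True
      then show ?thesis
        using has_periodD[OF that(2) i(1)] has_periodD[OF that(1), of "i + (q - p)"] i that(4)
        by simp
    next
      case False
      then show ?thesis
        using has_periodD[OF that(1), of "i - p"] has_periodD[OF that(2), of "i - p"] i that(3,4)
        by simp
    qed
  qed
  consider "p = 0 \<or> q = 0" | "0 < p" "p \<le> q" | "0 < q" "q \<le> p"
    by linarith
  then show ?case
  proof cases
    case 1
    then show ?thesis using less.prems by auto
  next
    case 2
    have "has_period u (gcd p (q - p)) l h"
      using less.hyps[of p "q - p"] diff[OF less.prems 2(2)] less.prems 2 by simp
    then show ?thesis using 2 by (metis gcd.commute gcd_diff1_nat)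
  next
    case 3
    have "has_period u (gcd q (p - q)) l h"
      using less.hyps[of q "p - q"] diff[OF less.prems(2,1)] less.prems 3 by simp
    then show ?thesis using 3 by (metis gcd.commute gcd_diff1_nat)
  qed
qed

lemma has_period_representative:
  assumes per: "has_period u p l h" and "0 < p" "l \<le> i" "i < h" "l \<le> t" "t + p \<le> h"
  obtains j where "t \<le> j" "j < t + p" "u j = u i" "j mod p = i mod p"
proof (cases "t \<le> i")
  case True
  define j r where "j = t + (i - t) mod p" and "r = (i - t) div p"
  have ij: "i = j + p * r"
    using True by (simp add: j_def r_def)
  have j: "t \<le> j" "j < t + p"
    using \<open>0 < p\<close> by (simp_all add: j_def)
  have "u j = u i"
    using has_period_mult[OF per, of j r] assms(4,5) j unfolding ij by simp
  moreover have "j mod p = i mod p"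
    unfolding ij by simp
  ultimately show thesis
    using that j by blast
next
  case False
  define r where "r = (t - i + (p - 1)) div p"
  have "p * r + (t - i + (p - 1)) mod p = t - i + (p - 1)"
    unfolding r_def by (rule mult_div_mod_eq)
  moreover have "(t - i + (p - 1)) mod p < p"
    using \<open>0 < p\<close> by simp
  ultimately have "t \<le> i + p * r" "i + p * r < t + p"
    using False by linarith+
  moreover from this have "u (i + p * r) = u i"
    using has_period_mult[OF per, of i r] assms by simp
  ultimately show thesis
    using that[of "i + p * r"] by simp
qed

text \<open>
  A sub-block of length \<open>p\<close> meets every class of positions modulo \<open>p\<close>, so it passes its own
  shorter period on to the whole block.
\<close>

lemma has_period_extend:
  assumes per: "has_period u p l h" and sub: "has_period u q l' h'"
    and "0 < p" "q dvd p" "l \<le> l'" "l' + p \<le> h'" "h' \<le> h"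
  shows "has_period u q l h"
  unfolding has_period_def
proof (intro allI impI)
  fix i assume i: "l \<le> i" "i + q < h"
  obtain j where j: "l' \<le> j" "j < l' + p" "u j = u i" "j mod p = i mod p"
    using has_period_representative[OF per, of i l'] assms i by auto
  obtain j' where j': "l' \<le> j'" "j' < l' + p" "u j' = u (i + q)" "j' mod p = (i + q) mod p"
    using has_period_representative[OF per, of "i + q" l'] assms i by auto
  have "j mod q = j' mod q"
    using j(4) j'(4) \<open>q dvd p\<close> by (metis mod_add_self2 mod_mod_cancel)
  then have "u j = u j'"
  proof (cases "j \<le> j'")
    case True
    then have "q dvd j' - j"
      using \<open>j mod q = j' mod q\<close> mod_eq_dvd_iff_nat by metis
    then show ?thesis
      using has_period_dvd[OF sub j(1), of "j' - j"] True j' assms by simp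
  next
    case False
    then have "q dvd j - j'"
      using \<open>j mod q = j' mod q\<close> mod_eq_dvd_iff_nat by (metis nat_le_linear)
    then show ?thesis
      using has_period_dvd[OF sub j'(1), of "j - j'"] False j assms by simp
  qed
  then show "u i = u (i + q)"
    using j j' by simp
qed

section \<open>Windows\<close>

abbreviation window :: "'a word \<Rightarrow> nat \<Rightarrow> nat \<Rightarrow> 'a list" where
  "window u s k \<equiv> u [s \<rightarrow> s + k]"

lemma window_eq_iff: "window u s k = window u t k \<longleftrightarrow> (\<forall>i<k. u (s + i) = u (t + i))"
  by (auto simp: list_eq_iff_nth_eq subsequence_def)

lemma window_drop_take:
  "i + k \<le> n \<Longrightarrow> take k (drop i (window u s n)) = window u (s + i) k"
  by (simp add: subsequence_def take_map drop_map add.assoc)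

lemma factors_of_length: "{w \<in> factors u. length w = n} = range (\<lambda>s. window u s n)"
proof -
  have "window u s n \<in> factors u" for s
    unfolding factors_def using le_add1[of s n] by blast
  moreover have "w \<in> range (\<lambda>s. window u s (length w))" if w: "w \<in> factors u" for w
  proof -
    obtain i j where "i \<le> j" "w = u [i \<rightarrow> j]"
      using w by (auto simp: factors_def)
    then have "w = window u i (length w)"
      by (simp add: subsequence_def)
    then show ?thesis by (rule range_eqI)
  qed
  moreover have "length (window u s n) = n" for s
    by (simp add: subsequence_def)
  ultimately show ?thesis
    by blast
qed

lemma finite_windows:
  assumes "finite (range u)"
  shows "finite (range (\<lambda>s. window u s n))"
  by (rule finite_subset[OF _ finite_lists_length_eq[OF assms, of n]])
    (auto simp: subsequence_def)

lemma palindrome_window: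
  assumes "palindrome (window u s k)" "i < k"
  shows "u (s + i) = u (s + (k - 1 - i))"
proof -
  have "rev (window u s k) ! i = window u s k ! i"
    using assms(1) by (simp add: palindrome_def)
  then show ?thesis using assms(2) by (simp add: rev_nth subsequence_def)
qed

lemma has_period_of_equal_windows:
  assumes "window u s n = window u (s + d) n"
  shows "has_period u d s (s + d + n)"
  unfolding has_period_def
proof (intro allI impI)
  fix i assume "s \<le> i" "i + d < s + d + n"
  then show "u i = u (i + d)"
    using assms[unfolded window_eq_iff, rule_format, of "i - s"] by (simp add: algebra_simps)
qed

lemma has_period_window_cong:
  assumes "window u s k = window u t k"
  shows "has_period u q s (s + k) \<longleftrightarrow> has_period u q t (t + k)"
proof -
  have "has_period u q t (t + k)"
    if eq: "window u s k = window u t k" and per: "has_period u q s (s + k)" for s t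
    unfolding has_period_def
  proof (intro allI impI)
    fix i assume "t \<le> i" "i + q < t + k"
    then show "u i = u (i + q)"
      using eq[unfolded window_eq_iff, rule_format, of "i - t"]
        eq[unfolded window_eq_iff, rule_format, of "i - t + q"]
        has_periodD[OF per, of "s + (i - t)"]
      by (simp add: algebra_simps)
  qed
  then show ?thesis using assms by metis
qed

section \<open>Few palindromes in a window\<close>

lemma period_of_two_palindromes:
  assumes "palindrome (window u a k)" "palindrome (window u (a + d) k)"
  shows "has_period u (2 * d) a (a + d + k)"
  unfolding has_period_def
proof (intro allI impI)
  fix i assume i: "a \<le> i" "i + 2 * d < a + d + k"
  \<comment> \<open>The common letter sits at the mirror image of \<open>i\<close> in the first palindrome, which is also
    the mirror image of \<open>i + 2 * d\<close> in the second.\<close>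
  have "u i = u (a + (k - 1 - (i - a)))"
    using palindrome_window[OF assms(1), of "i - a"] i by simp
  also have "\<dots> = u (a + d + (k - 1 - (i + d - a)))"
    using i by (intro arg_cong[of _ _ u]) linarith
  also have "\<dots> = u (a + d + (i + d - a))"
    using palindrome_window[OF assms(2), of "i + d - a"] i by simp
  also have "\<dots> = u (i + 2 * d)"
    using i by (intro arg_cong[of _ _ u]) linarith
  finally show "u i = u (i + 2 * d)" .
qed

text \<open>
  The first two palindromes give the period \<open>2 * x\<close>, the last two the period \<open>2 * y\<close>.  Both hold
  on the middle palindrome, which is long enough to have period \<open>2 * gcd x y\<close>, and this
  period then spreads over all three.  Of the numbers \<open>x\<close>, \<open>y\<close>, \<open>x + y\<close>, at least one is an
  even multiple of \<open>gcd x y\<close>, hence a multiple of the period.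
\<close>

lemma three_close_palindromes:
  assumes pal: "palindrome (window u a k)" "palindrome (window u (a + x) k)"
      "palindrome (window u (a + x + y) k)"
    and pos: "0 < x" "0 < y" and close: "4 * (x + y) \<le> k"
  shows "window u a k = window u (a + x) k \<or>
    window u (a + x) k = window u (a + x + y) k \<or>
    window u a k = window u (a + x + y) k"
proof -
  define g where "g = gcd x y"
  have px: "has_period u (2 * x) a (a + x + k)"
    by (rule period_of_two_palindromes[OF pal(1,2)])
  have py: "has_period u (2 * y) (a + x) (a + x + y + k)"
    by (rule period_of_two_palindromes[OF pal(2,3)])
  have "has_period u (gcd (2 * x) (2 * y)) (a + x) (a + x + k)"
    by (rule has_period_gcd)
      (use close in \<open>auto intro: has_period_subblock[OF px] has_period_subblock[OF py]\<close>)
  then have mid: "has_period u (2 * g) (a + x) (a + x + k)"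
    by (simp add: g_def gcd_mult_distrib_nat)
  have "has_period u (2 * g) a (a + x + k)"
    by (rule has_period_extend[OF px mid]) (use pos close in \<open>auto simp: g_def\<close>)
  moreover have "has_period u (2 * g) (a + x) (a + x + y + k)"
    by (rule has_period_extend[OF py mid]) (use pos close in \<open>auto simp: g_def\<close>)
  moreover have "g \<le> x"
    using pos by (simp add: g_def)
  ultimately have all: "has_period u (2 * g) a (a + x + y + k)"
    using close by - (rule has_period_union[where h = "a + x + k" and l' = "a + x"], auto)
  have some: "2 * g dvd x \<or> 2 * g dvd y \<or> 2 * g dvd x + y"
  proof -
    obtain x' y' where xy: "x = g * x'" "y = g * y'"
      by (metis g_def gcd_dvd1 gcd_dvd2 dvdE)
    have "even x' \<or> even y' \<or> even (x' + y')" by auto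
    then have "g * 2 dvd g * x' \<or> g * 2 dvd g * y' \<or> g * 2 dvd g * (x' + y')"
      by (meson mult_dvd_mono dvd_refl)
    then show ?thesis by (simp add: xy algebra_simps)
  qed
  have "window u b k = window u (b + d) k"
    if "2 * g dvd d" "a \<le> b" "b + d \<le> a + x + y" for b d
    unfolding window_eq_iff
  proof (intro allI impI)
    fix i assume "i < k"
    then show "u (b + i) = u (b + d + i)"
      using has_period_dvd[OF all, of "b + i" d] that by (simp add: algebra_simps)
  qed
  from this[of x a] this[of y "a + x"] this[of "x + y" a]
  have "2 * g dvd x \<Longrightarrow> window u a k = window u (a + x) k"
    "2 * g dvd y \<Longrightarrow> window u (a + x) k = window u (a + x + y) k"
    "2 * g dvd x + y \<Longrightarrow> window u a k = window u (a + x + y) k"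
    by (simp_all add: add.assoc)
  with some show ?thesis
    by blast
qed

text \<open>
  The bound counts words, not occurrences: a word may well recur inside one window.
\<close>

lemma window_palindromes_le_2:
  "card {w \<in> (\<lambda>i. window u i k) ` {t..t + k div 4}. palindrome w} \<le> 2"
    (is "card ?P \<le> 2")
proof (rule ccontr)
  assume "\<not> card ?P \<le> 2"
  then obtain S where "S \<subseteq> ?P" "card S = 3"
    using obtain_subset_with_card_n[of 3 ?P] by auto
  then obtain v w z where vwz: "{v, w, z} \<subseteq> ?P" "v \<noteq> w" "w \<noteq> z" "v \<noteq> z"
    by (auto simp: card_3_iff)
  define I where "I = {i \<in> {t..t + k div 4}. palindrome (window u i k)}"
  have sorted: "window u a k = window u b k \<or> window u b k = window u c k \<or>
      window u a k = window u c k" if "a < b" "b < c" "a \<in> I" "b \<in> I" "c \<in> I" for a b c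
  proof -
    have "4 * (b - a + (c - b)) \<le> k"
      using that by (auto simp: I_def)
    then show ?thesis
      using three_close_palindromes[of u a k "b - a" "c - b"] that by (auto simp: I_def)
  qed
  obtain a b c where abc: "v = window u a k" "w = window u b k" "z = window u c k"
    "a \<in> I" "b \<in> I" "c \<in> I"
    using vwz(1) by (auto simp: I_def)
  then have "a \<noteq> b" "b \<noteq> c" "a \<noteq> c"
    using vwz by auto
  then show False
    using sorted[of a b c] sorted[of a c b] sorted[of b a c] sorted[of b c a] sorted[of c a b]
      sorted[of c b a] abc vwz(2-4) by (simp add: linorder_neq_iff) metis
qed

section \<open>Many windows around a word\<close>

text \<open>
  A coincidence of two windows at distance \<open>d\<close> forces the period \<open>d\<close> on everything between
  them.  Without a period at most \<open>m\<close> in the word there is nothing to do.  Otherwise \<open>q\<close> is the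
  least such period, and the word is moved by multiples of \<open>q\<close> as far to the right as the run
  of period \<open>q\<close> permits; the letter at position \<open>e\<close> is the first to violate that period, and it
  comes less than \<open>q\<close> letters after the word.  The word also has the period \<open>gcd d q\<close>, so \<open>q\<close>
  divides \<open>d\<close> by minimality.  If the right-hand window reaches \<open>e\<close>, then the letters at \<open>e\<close>,
  \<open>e - d\<close> and \<open>e - q\<close> agree, which is impossible; if not, then both windows start within \<open>q\<close>
  consecutive positions, whence \<open>d < q\<close>.
\<close>

lemma distinct_windows_around_word:
  assumes aper: "\<not> ultimately_periodic u" and "2 * m \<le> k" "m \<le> s"
  obtains s' where "s \<le> s'" "window u s' k = window u s k"
    "inj_on (\<lambda>i. window u (s' - i) (k + m)) {..m}"
proof (cases "\<exists>q. 0 < q \<and> q \<le> m \<and> has_period u q s (s + k)")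
  case False
  have "inj_on (\<lambda>i. window u (s - i) (k + m)) {..m}"
  proof (rule linorder_inj_onI)
    fix i j assume ij: "i < j" "i \<in> {..m}" "j \<in> {..m}"
    show "window u (s - i) (k + m) \<noteq> window u (s - j) (k + m)"
    proof
      assume "window u (s - i) (k + m) = window u (s - j) (k + m)"
      then have "has_period u (j - i) (s - j) (s - j + (j - i) + (k + m))"
        using has_period_of_equal_windows[of u "s - j" "k + m" "j - i"] ij assms by simp
      then have "has_period u (j - i) s (s + k)"
        by (rule has_period_subblock) (use ij assms in auto)
      moreover have "0 < j - i" "j - i \<le> m"
        using ij by auto
      ultimately show False
        using False by blast
    qed
  qed auto
  then show thesis using that[of s] by simp
next
  case True
  define q where "q = (LEAST q. 0 < q \<and> q \<le> m \<and> has_period u q s (s + k))"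
  have q: "0 < q" "q \<le> m" "has_period u q s (s + k)"
    using LeastI_ex[OF True] by (auto simp: q_def)
  have q_least: "q \<le> r" if "0 < r" "r \<le> m" "has_period u r s (s + k)" for r
    unfolding q_def by (rule Least_le) (use that in simp)
  have ex_break: "\<exists>e. s + q \<le> e \<and> u e \<noteq> u (e - q)"
  proof (rule ccontr)
    assume none: "\<nexists>e. s + q \<le> e \<and> u e \<noteq> u (e - q)"
    have "u (i + q) = u i" if "s \<le> i" for i
      using none[simplified, rule_format, of "i + q"] that by simp
    moreover have "1 \<le> q" using q(1) by simp
    ultimately show False
      using aper unfolding ultimately_periodic_def by blast
  qed
  define e where "e = (LEAST e. s + q \<le> e \<and> u e \<noteq> u (e - q))"
  have e: "s + q \<le> e" "u e \<noteq> u (e - q)"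
    using LeastI_ex[OF ex_break] by (auto simp: e_def)
  have run: "has_period u q s e"
    unfolding has_period_def
  proof (intro allI impI)
    fix i assume "s \<le> i" "i + q < e"
    then show "u i = u (i + q)"
      using not_less_Least[of "i + q" "\<lambda>e. s + q \<le> e \<and> u e \<noteq> u (e - q)"]
      by (simp add: e_def)
  qed
  have "s + k \<le> e"
  proof (rule ccontr)
    assume "\<not> s + k \<le> e"
    then have "s \<le> e - q" "e - q + q < s + k"
      using e(1) by auto
    then show False
      using has_periodD[OF q(3), of "e - q"] e by simp
  qed
  define r where "r = (e - s - k) div q"
  define s' where "s' = s + q * r"
  have "q * r + (e - s - k) mod q = e - s - k" "(e - s - k) mod q < q"
    unfolding r_def by (rule mult_div_mod_eq) (simp add: q(1))
  then have s': "s' + k \<le> e" "e < s' + k + q"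
    unfolding s'_def using \<open>s + k \<le> e\<close> by linarith+
  have same: "window u s' k = window u s k"
    unfolding window_eq_iff
  proof (intro allI impI)
    fix i assume "i < k"
    then show "u (s' + i) = u (s + i)"
      using has_period_mult[OF run, of "s + i" r] s' by (simp add: s'_def algebra_simps)
  qed
  have "inj_on (\<lambda>i. window u (s' - i) (k + m)) {..m}"
  proof (rule linorder_inj_onI)
    fix i j assume ij: "i < j" "i \<in> {..m}" "j \<in> {..m}"
    define d where "d = j - i"
    have d: "0 < d" "d \<le> m" "j = i + d"
      using ij by (auto simp: d_def)
    have "s \<le> s'" by (simp add: s'_def)
    show "window u (s' - i) (k + m) \<noteq> window u (s' - j) (k + m)"
    proof
      assume "window u (s' - i) (k + m) = window u (s' - j) (k + m)"
      then have per: "has_period u d (s' - j) (s' - j + d + (k + m))"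
        using has_period_of_equal_windows[of u "s' - j" "k + m" d] ij assms \<open>s \<le> s'\<close>
        by (simp add: d_def)
      have "has_period u d s' (s' + k)"
        by (rule has_period_subblock[OF per]) (use d ij assms \<open>s \<le> s'\<close> in auto)
      moreover have "has_period u q s' (s' + k)"
        using q(3) same has_period_window_cong by metis
      ultimately have "has_period u (gcd d q) s' (s' + k)"
        by (rule has_period_gcd) (use d q assms in simp)
      then have "has_period u (gcd d q) s (s + k)"
        using same has_period_window_cong by metis
      moreover have "gcd d q \<le> q" "0 < gcd d q"
        using q(1) by (auto intro: gcd_le2_nat)
      ultimately have "gcd d q = q"
        using q_least[of "gcd d q"] q(2) by simp
      then have "q dvd d" using gcd_dvd1[of d q] by simp
      then have "q \<le> d" using d(1) by (rule dvd_imp_le)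
      show False
      proof (cases "e < s' - i + (k + m)")
        case True
        have "u (e - d) = u e"
          using has_periodD[OF per, of "e - d"] True s' d ij assms \<open>s \<le> s'\<close> by simp
        moreover have "u (e - d) = u (e - q)"
          using has_period_dvd[OF run, of "e - d" "d - q"] \<open>q dvd d\<close> \<open>q \<le> d\<close> s' d assms q \<open>s \<le> s'\<close>
          by (simp add: dvd_diff_nat)
        ultimately show False using e(2) by simp
      next
        case False
        then show False
          using s' d ij assms \<open>s \<le> s'\<close> \<open>q \<le> d\<close> by simp
      qed
    qed
  qed auto
  then show thesis
    using that[of s'] same by (simp add: s'_def)
qed

text \<open>
  The bound \<open>m \<le> s\<close> leaves room for \<open>m\<close> letters to the left of the word; a word that occurs only
  near the beginning of \<open>u\<close> may lie in fewer windows.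
\<close>

lemma late_word_many_windows:
  assumes "finite (range u)" "\<not> ultimately_periodic u" "2 * m \<le> k" "m \<le> s"
  shows "m + 1 \<le> card {w \<in> range (\<lambda>s. window u s (k + m)).
    \<exists>i\<le>m. take k (drop i w) = window u s k}" (is "_ \<le> card ?W")
proof -
  obtain s' where s': "s \<le> s'" "window u s' k = window u s k"
    "inj_on (\<lambda>i. window u (s' - i) (k + m)) {..m}"
    using distinct_windows_around_word[OF assms(2-4)] .
  have "(\<lambda>i. window u (s' - i) (k + m)) ` {..m} \<subseteq> ?W"
  proof
    fix w assume "w \<in> (\<lambda>i. window u (s' - i) (k + m)) ` {..m}"
    then obtain i where i: "i \<le> m" "w = window u (s' - i) (k + m)" by auto
    then have "take k (drop i w) = window u s k"
      using window_drop_take[of i k "k + m" u "s' - i"] s' assms(4) by simp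
    then show "w \<in> ?W" using i by auto
  qed
  then have "card ((\<lambda>i. window u (s' - i) (k + m)) ` {..m}) \<le> card ?W"
    by (rule card_mono[rotated]) (simp add: finite_windows[OF assms(1)])
  then show ?thesis
    using card_image[OF s'(3)] by simp
qed

section \<open>Counting\<close>

lemma double_counting_le:
  fixes R :: "'a \<Rightarrow> 'b \<Rightarrow> bool"
  assumes "finite P" "finite W"
    and "\<And>p. p \<in> P \<Longrightarrow> a \<le> card {w \<in> W. R p w}"
    and "\<And>w. w \<in> W \<Longrightarrow> card {p \<in> P. R p w} \<le> b"
  shows "a * card P \<le> b * card W"
proof -
  have "a * card P \<le> (\<Sum>p\<in>P. card {w \<in> W. R p w})"
    using sum_bounded_below[of P a "\<lambda>p. card {w \<in> W. R p w}"] assms(3) by (simp add: mult.commute)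
  also have "\<dots> = (\<Sum>w\<in>W. card {p \<in> P. R p w})"
    by (rule sum_multicount_gen) (use assms in auto)
  also have "\<dots> \<le> b * card W"
    using sum_bounded_above[of W "\<lambda>w. card {p \<in> P. R p w}" b] assms(4) by (simp add: mult.commute)
  finally show ?thesis .
qed

theorem theorem12:
  fixes A :: "'a set" and u :: "'a word"
  assumes "finite A"
    and "range u \<subseteq> A"
    and "\<not> ultimately_periodic u"
  shows "\<forall>k::nat. k \<ge> 1 \<longrightarrow>
    real (pal u k) < 16 / real k * real (fac u (k + nat \<lfloor>real k / 4\<rfloor>))"
proof (intro allI impI)
  fix k :: nat assume "k \<ge> 1"
  define m where "m = k div 4"
  define P where "P = {w \<in> (\<lambda>s. window u s k) ` {m..}. palindrome w}"
  define Q where "Q = {w \<in> (\<lambda>s. window u s k) ` {0..m}. palindrome w}"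
  define W where "W = range (\<lambda>s. window u s (k + m))"
  have fin: "finite (range u)"
    using assms(1,2) finite_subset by blast
  have "finite P"
    by (rule finite_subset[OF _ finite_windows[OF fin, of k]]) (auto simp: P_def)
  have "finite W"
    by (simp add: W_def finite_windows[OF fin])
  have fac: "fac u (k + m) = card W"
    by (simp add: fac_def factors_of_length W_def)
  have m: "2 * m \<le> k" "k < 4 * (m + 1)"
    by (auto simp: m_def)

  have "{w \<in> factors u. length w = k \<and> palindrome w} = P \<union> Q"
  proof -
    have "{w \<in> factors u. length w = k \<and> palindrome w}
        = {w \<in> range (\<lambda>s. window u s k). palindrome w}"
      using factors_of_length[of u k] by blast
    also have "\<dots> = P \<union> Q"
    proof -
      have "(UNIV :: nat set) = {m..} \<union> {0..m}" by auto
      then have "range (\<lambda>s. window u s k)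
          = (\<lambda>s. window u s k) ` {m..} \<union> (\<lambda>s. window u s k) ` {0..m}"
        by (metis image_Un)
      then show ?thesis by (auto simp: P_def Q_def)
    qed
    finally show ?thesis .
  qed
  moreover have "card Q \<le> 2"
    using window_palindromes_le_2[of u k 0] by (simp add: Q_def m_def)
  ultimately have pal: "pal u k \<le> card P + 2"
    unfolding pal_def using card_Un_le[of P Q] by simp

  have P_le: "(m + 1) * card P \<le> 2 * card W"
  proof (rule double_counting_le[where R = "\<lambda>p w. \<exists>i\<le>m. take k (drop i w) = p"])
    fix p assume "p \<in> P"
    then show "m + 1 \<le> card {w \<in> W. \<exists>i\<le>m. take k (drop i w) = p}"
      using late_word_many_windows[OF fin assms(3) m(1)] unfolding P_def W_def by blast
  next
    fix w assume "w \<in> W"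
    then obtain t where w: "w = window u t (k + m)" by (auto simp: W_def)
    have "{p \<in> P. \<exists>i\<le>m. take k (drop i w) = p}
        \<subseteq> {p \<in> (\<lambda>i. window u i k) ` {t..t + k div 4}. palindrome p}"
    proof
      fix p assume p: "p \<in> {p \<in> P. \<exists>i\<le>m. take k (drop i w) = p}"
      then obtain i where i: "i \<le> m" "p = window u (t + i) k"
        using window_drop_take[of _ k "k + m" u t] by (auto simp: w)
      then have "p \<in> (\<lambda>i. window u i k) ` {t..t + k div 4}"
        by (intro image_eqI[of _ _ "t + i"]) (simp_all add: m_def)
      then show "p \<in> {p \<in> (\<lambda>i. window u i k) ` {t..t + k div 4}. palindrome p}"
        using p by (auto simp: P_def)
    qed
    then have "card {p \<in> P. \<exists>i\<le>m. take k (drop i w) = p}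
        \<le> card {p \<in> (\<lambda>i. window u i k) ` {t..t + k div 4}. palindrome p}"
      by (rule card_mono[rotated]) simp
    then show "card {p \<in> P. \<exists>i\<le>m. take k (drop i w) = p} \<le> 2"
      using window_palindromes_le_2[of u k t] by linarith
  qed fact+

  \<comment> \<open>The windows around the word at position \<open>m\<close>, palindrome or not, are already this many.\<close>
  have W_ge: "m + 1 \<le> card W"
    using late_word_many_windows[OF fin assms(3) m(1) order_refl]
      card_mono[OF \<open>finite W\<close>, of "{w \<in> W. \<exists>i\<le>m. take k (drop i w) = window u m k}"]
    by (simp add: W_def)

  have "pal u k * k \<le> (card P + 2) * k"
    using pal by (rule mult_le_mono1)
  also have "\<dots> < (card P + 2) * (4 * (m + 1))"
    using m(2) by (rule mult_less_mono2) simp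
  also have "\<dots> = 4 * ((m + 1) * card P) + 8 * (m + 1)"
    by (simp add: algebra_simps)
  also have "\<dots> \<le> 4 * (2 * card W) + 8 * card W"
    using P_le W_ge by (intro add_le_mono mult_le_mono2)
  also have "\<dots> = 16 * card W"
    by simp
  finally have "real (pal u k * k) < real (16 * fac u (k + m))"
    by (simp only: of_nat_less_iff fac)
  moreover have "nat \<lfloor>real k / 4\<rfloor> = m"
    using floor_divide_of_nat_eq[of k 4, where 'a = real] by (simp add: m_def)
  ultimately show "real (pal u k) < 16 / real k * real (fac u (k + nat \<lfloor>real k / 4\<rfloor>))"
    using \<open>k \<ge> 1\<close> by (simp add: field_simps)
qed

end
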